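(* The intersection of two internal sets need not be internal: there exist a locally convex vector space $E$ and internal subsets $A,B\subseteq\mathcal G_E$ such that $A\cap B$ is not internal.
   Context: For a locally convex space $E$ with topology generated by seminorms $(p_i)_{i\in I}$: a net $(u_\varepsilon)_\varepsilon\in E^{(0,1)}$ is moderate if for each $i\in I$ there are $M\in\mathbb N$ and $\eta\in(0,1)$ with $p_i(u_\varepsilon)\le\varepsilon^{-M}$ for all $\varepsilon\le\eta$; it is negligible if for each $i\in I$ and each $m\in\mathbb N$ there is $\eta\in(0,1)$ with $p_i(u_\varepsilon)\le\varepsilon^m$ for all $\varepsilon\le\eta$. The Colombeau space based on $E$ is the quotient $\mathcal G_E$ of the moderate nets by the negligible nets; a net in the class $u\in\mathcal G_E$ is called a representative of $u$. A subset $A\subseteq\mathcal G_E$ is internal if there is a net $(A_\varepsilon)_{\varepsilon\in(0,1)}$ of subsets of $E$ such that $A=[(A_\varepsilon)_\varepsilon]$, the set of all $u\in\mathcal G_E$ for which there exist a representative $(u_\varepsilon)_\varepsilon$ of $u$ and $\eta>0$ such that $u_\varepsilon\in A_\varepsilon$ for all $\varepsilon<\eta$. *)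

theory Defs
  imports Complex_Main "HOL-Library.FuncSet" "HOL-Algebra.Module"
begin

text \<open>
  Scalars range over the class \<open>real_normed_field\<close>, whose instances include \<open>real\<close> and
  \<open>complex\<close>. Vector spaces are carrier-based modules over the scalars, so that one can quantify
  over them inside a formula: the type \<open>'a\<close> in \<open>('k, 'a) module\<close> only supplies elements for the
  carrier, and any operations it may have of its own play no role. The multiplicative components
  that the record type inherits from rings are not constrained.
\<close>

definition scalars :: "'k::real_normed_field ring" where
  "scalars = \<lparr>carrier = UNIV, monoid.mult = (*), one = 1, ring.zero = 0, add = (+)\<rparr>"

definition seminorm_on :: "('k::real_normed_field, 'a) module \<Rightarrow> ('a \<Rightarrow> real) \<Rightarrow> bool" where
  "seminorm_on E p \<longleftrightarrow>
     (\<forall>x\<in>carrier E. \<forall>y\<in>carrier E. p (x \<oplus>\<^bsub>E\<^esub> y) \<le> p x + p y) \<and>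
     (\<forall>c. \<forall>x\<in>carrier E. p (c \<odot>\<^bsub>E\<^esub> x) = norm c * p x)"

text \<open>
  A generating family of seminorms is given as the set \<open>P\<close> of its members. Everything below only
  quantifies over the members of the family, so the indexing plays no role. The topology is the one
  generated by \<open>P\<close>; it is not required to be Hausdorff.
\<close>

definition locally_convex_space ::
  "('k::real_normed_field, 'a) module \<Rightarrow> ('a \<Rightarrow> real) set \<Rightarrow> bool" where
  "locally_convex_space E P \<longleftrightarrow> module scalars E \<and> (\<forall>p\<in>P. seminorm_on E p)"

definition nets :: "('k, 'a) module \<Rightarrow> (real \<Rightarrow> 'a) set" where
  "nets E = {0<..<1} \<rightarrow>\<^sub>E carrier E"

definition moderate_nets :: "('k, 'a) module \<Rightarrow> ('a \<Rightarrow> real) set \<Rightarrow> (real \<Rightarrow> 'a) set" where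
  "moderate_nets E P = {u \<in> nets E.
     \<forall>p\<in>P. \<exists>M::nat. \<exists>\<eta>\<in>{0<..<1}. \<forall>\<epsilon>\<in>{0<..\<eta>}. p (u \<epsilon>) \<le> \<epsilon> powi (- int M)}"

definition negligible_nets :: "('k, 'a) module \<Rightarrow> ('a \<Rightarrow> real) set \<Rightarrow> (real \<Rightarrow> 'a) set" where
  "negligible_nets E P = {u \<in> nets E.
     \<forall>p\<in>P. \<forall>m::nat. \<exists>\<eta>\<in>{0<..<1}. \<forall>\<epsilon>\<in>{0<..\<eta>}. p (u \<epsilon>) \<le> \<epsilon> ^ m}"

definition colombeau_rel ::
  "('k, 'a) module \<Rightarrow> ('a \<Rightarrow> real) set \<Rightarrow> ((real \<Rightarrow> 'a) \<times> (real \<Rightarrow> 'a)) set" where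
  "colombeau_rel E P = {(u, v). u \<in> moderate_nets E P \<and> v \<in> moderate_nets E P \<and>
     (\<lambda>\<epsilon>\<in>{0<..<1}. u \<epsilon> \<ominus>\<^bsub>E\<^esub> v \<epsilon>) \<in> negligible_nets E P}"

text \<open>The elements of the quotient are equivalence classes; their members are the representatives.\<close>

definition colombeau_space ::
  "('k, 'a) module \<Rightarrow> ('a \<Rightarrow> real) set \<Rightarrow> (real \<Rightarrow> 'a) set set" where
  "colombeau_space E P = moderate_nets E P // colombeau_rel E P"

definition internal_set_of ::
  "('k, 'a) module \<Rightarrow> ('a \<Rightarrow> real) set \<Rightarrow> (real \<Rightarrow> 'a set) \<Rightarrow> (real \<Rightarrow> 'a) set set" where
  "internal_set_of E P A = {u \<in> colombeau_space E P.
     \<exists>v\<in>u. \<exists>\<eta>>0. \<forall>\<epsilon>\<in>{0<..<1}. \<epsilon> < \<eta> \<longrightarrow> v \<epsilon> \<in> A \<epsilon>}"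

definition internal ::
  "('k, 'a) module \<Rightarrow> ('a \<Rightarrow> real) set \<Rightarrow> (real \<Rightarrow> 'a) set set \<Rightarrow> bool" where
  "internal E P S \<longleftrightarrow>
     (\<exists>A. (\<forall>\<epsilon>\<in>{0<..<1}. A \<epsilon> \<subseteq> carrier E) \<and> S = internal_set_of E P A)"

end

theory Submission
  imports Defs
begin

text \<open>
  The counterexample lives on the scalar line \<open>E = 'k\<close> with its norm. Let \<open>A\<^sub>\<epsilon>\<close> consist of the
  integers \<open>n \<ge> 1\<close> and \<open>B\<^sub>\<epsilon>\<close> of the points \<open>n + \<epsilon>\<^sup>n\<close> with \<open>n \<ge> 1\<close>. The gap \<open>\<epsilon>\<^sup>n\<close> between
  corresponding points is not negligible as long as \<open>n\<close> stays bounded, but it becomes negligible as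
  soon as \<open>n = n\<^sub>\<epsilon>\<close> tends to infinity. So \<open>[A\<^sub>\<epsilon>] \<inter> [B\<^sub>\<epsilon>]\<close> consists of the classes of the moderate
  nets of integers \<open>n\<^sub>\<epsilon> \<rightarrow> \<infinity>\<close>. The proof uses two consequences of this: the nets with \<open>n\<^sub>\<epsilon> \<rightarrow> \<infinity>\<close>
  and \<open>n\<^sub>\<epsilon> \<le> 1/\<epsilon>\<close> are in the intersection (\<open>diverging_in_Int\<close>), while bounded nets are not
  (\<open>bounded_notin_Int\<close>).

  Divergence to infinity is an external condition, which no net of sets \<open>C\<^sub>\<epsilon>\<close> can express: if
  \<open>[C\<^sub>\<epsilon>]\<close> contains all these nets \<open>n\<^sub>\<epsilon> \<rightarrow> \<infinity>\<close>, then a diagonal argument (\<open>diagonal_underspill\<close>)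
  gives one fixed \<open>k\<close> such that \<open>C\<^sub>\<epsilon>\<close> has a point within distance \<open>1\<close> of \<open>k\<close> for all small
  \<open>\<epsilon>\<close>. Picking such points yields a bounded net in \<open>[C\<^sub>\<epsilon>]\<close>, so \<open>[C\<^sub>\<epsilon>]\<close> is not the intersection.
\<close>

section \<open>Small parameters\<close>

lemma eventually_at_right_0_closed:
  "(\<exists>\<eta>\<in>{0<..<1}. \<forall>\<epsilon>\<in>{0<..\<eta>}. Q \<epsilon>) \<longleftrightarrow> (\<forall>\<^sub>F \<epsilon> in at_right (0::real). Q \<epsilon>)"
proof
  assume "\<exists>\<eta>\<in>{0<..<1}. \<forall>\<epsilon>\<in>{0<..\<eta>}. Q \<epsilon>"
  then show "\<forall>\<^sub>F \<epsilon> in at_right 0. Q \<epsilon>"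
    by (force simp: eventually_at_right_field)
next
  assume "\<forall>\<^sub>F \<epsilon> in at_right 0. Q \<epsilon>"
  then obtain b where "b > 0" "\<And>\<epsilon>. \<epsilon> > 0 \<Longrightarrow> \<epsilon> < b \<Longrightarrow> Q \<epsilon>"
    by (auto simp: eventually_at_right_field)
  then show "\<exists>\<eta>\<in>{0<..<1}. \<forall>\<epsilon>\<in>{0<..\<eta>}. Q \<epsilon>"
    by (intro bexI[of _ "min (b/2) (1/2)"]) auto
qed

lemma eventually_at_right_0_open:
  "(\<exists>\<eta>>0. \<forall>\<epsilon>\<in>{0<..<1}. \<epsilon> < \<eta> \<longrightarrow> Q \<epsilon>) \<longleftrightarrow> (\<forall>\<^sub>F \<epsilon> in at_right (0::real). Q \<epsilon>)"
proof
  assume "\<exists>\<eta>>0. \<forall>\<epsilon>\<in>{0<..<1}. \<epsilon> < \<eta> \<longrightarrow> Q \<epsilon>"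
  then obtain \<eta> where "\<eta> > 0" "\<forall>\<epsilon>\<in>{0<..<1}. \<epsilon> < \<eta> \<longrightarrow> Q \<epsilon>" by blast
  then show "\<forall>\<^sub>F \<epsilon> in at_right 0. Q \<epsilon>"
    unfolding eventually_at_right_field by (intro exI[of _ "min \<eta> 1"]) auto
next
  assume "\<forall>\<^sub>F \<epsilon> in at_right 0. Q \<epsilon>"
  then show "\<exists>\<eta>>0. \<forall>\<epsilon>\<in>{0<..<1}. \<epsilon> < \<eta> \<longrightarrow> Q \<epsilon>"
    by (auto simp: eventually_at_right_field)
qed

lemma eventually_at_right_0_small:
  "c > 0 \<Longrightarrow> \<forall>\<^sub>F \<epsilon> in at_right (0::real). 0 < \<epsilon> \<and> \<epsilon> < c"
  by (auto simp: eventually_at_right_field)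

text \<open>
  Underspill: if every fixed \<open>k\<close> failed at arbitrarily small parameters, choose for each \<open>k\<close> such a
  parameter \<open>e k < 1 / (k + 1)\<close> and let \<open>n\<close> take the value \<open>k\<close> there. This \<open>n\<close> still tends to
  infinity, because only finitely many of the \<open>e k\<close> belong to \<open>k\<close> below a given bound, yet it hits
  a failure at arbitrarily small parameters.
\<close>

lemma diagonal_underspill:
  fixes R :: "nat \<Rightarrow> real \<Rightarrow> bool"
  assumes R: "\<And>n. filterlim n at_top (at_right 0) \<Longrightarrow> (\<forall>\<epsilon>>0. real (n \<epsilon>) \<le> 1 / \<epsilon>) \<Longrightarrow>
                \<forall>\<^sub>F \<epsilon> in at_right 0. R (n \<epsilon>) \<epsilon>"
  shows "\<exists>k. \<forall>\<^sub>F \<epsilon> in at_right 0. R k \<epsilon>"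
proof (rule ccontr)
  assume neg: "\<nexists>k. \<forall>\<^sub>F \<epsilon> in at_right 0. R k \<epsilon>"
  have "\<exists>\<epsilon>. 0 < \<epsilon> \<and> \<epsilon> < 1 / real (k + 1) \<and> \<not> R k \<epsilon>" for k
  proof (rule ccontr)
    assume "\<not> ?thesis"
    then have "\<forall>\<^sub>F \<epsilon> in at_right 0. R k \<epsilon>"
      unfolding eventually_at_right_field by (intro exI[of _ "1 / real (k + 1)"]) auto
    with neg show False by blast
  qed
  then obtain e where e: "\<And>k. 0 < e k" "\<And>k. e k < 1 / real (k + 1)" "\<And>k. \<not> R k (e k)"
    by metis
  define n where "n \<epsilon> = (if \<epsilon> \<in> range e then SOME k. e k = \<epsilon> else nat \<lfloor>1 / \<epsilon>\<rfloor>)" for \<epsilon>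
  have en: "e (n \<epsilon>) = \<epsilon>" if "\<epsilon> \<in> range e" for \<epsilon>
  proof -
    have "\<exists>k. e k = \<epsilon>" using that by auto
    from someI_ex[OF this] show ?thesis using that by (simp add: n_def)
  qed
  have bound: "real (n \<epsilon>) \<le> 1 / \<epsilon>" if "\<epsilon> > 0" for \<epsilon>
  proof (cases "\<epsilon> \<in> range e")
    case True
    then have "\<epsilon> * real (n \<epsilon> + 1) < 1"
      using e(2)[of "n \<epsilon>"] en[OF True] by (simp add: field_simps)
    then show ?thesis using that by (simp add: field_simps)
  next
    case False
    then show ?thesis using that by (simp add: n_def)
  qed
  have lim: "filterlim n at_top (at_right 0)"
    unfolding filterlim_at_top
  proof
    fix K
    have "\<forall>\<^sub>F \<epsilon> in at_right 0. \<forall>k\<in>{..<K}. 0 < \<epsilon> \<and> \<epsilon> < e k"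
      by (intro eventually_ball_finite ballI eventually_at_right_0_small e) auto
    moreover have "\<forall>\<^sub>F \<epsilon> in at_right 0. 0 < \<epsilon> \<and> \<epsilon> < 1 / real (K + 1)"
      by (intro eventually_at_right_0_small) simp
    ultimately show "\<forall>\<^sub>F \<epsilon> in at_right 0. K \<le> n \<epsilon>"
    proof eventually_elim
      case (elim \<epsilon>)
      show ?case
      proof (cases "\<epsilon> \<in> range e")
        case True
        then show ?thesis using elim(1) en[OF True] by (metis lessThan_iff less_irrefl not_le)
      next
        case False
        have "real K \<le> 1 / \<epsilon>" using elim(2) by (simp add: field_simps)
        then have "int K \<le> \<lfloor>1 / \<epsilon>\<rfloor>" by linarith
        then show ?thesis using False by (simp add: n_def)
      qed
    qed
  qed
  from R[OF lim] bound obtain b where b: "b > 0" "\<And>\<epsilon>. 0 < \<epsilon> \<Longrightarrow> \<epsilon> < b \<Longrightarrow> R (n \<epsilon>) \<epsilon>"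
    by (auto simp: eventually_at_right_field)
  obtain k where k: "1 / real (k + 1) < b" using reals_Archimedean[OF b(1)]
    by (auto simp: inverse_eq_divide)
  have "R (n (e k)) (e k)" using b(2)[of "e k"] e(1,2)[of k] k by linarith
  moreover have "\<not> R (n (e k)) (e k)" using e(3)[of "n (e k)"] en[of "e k"] by simp
  ultimately show False by blast
qed

section \<open>The scalar line\<close>

text \<open>
  The scalar \<open>c\<close> is represented by the constant function \<open>\<lambda>_. c\<close>, so that evaluation at any
  index recovers it.
\<close>

definition line :: "('k::real_normed_field, nat \<Rightarrow> 'k) module" where
  "line = \<lparr>carrier = range (\<lambda>c _. c), monoid.mult = (\<lambda>x y i. x i * y i), one = (\<lambda>_. 1),
     ring.zero = (\<lambda>_. 0), add = (\<lambda>x y i. x i + y i), smult = (\<lambda>c x i. c * x i)\<rparr>"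

definition line_norms :: "((nat \<Rightarrow> 'k::real_normed_field) \<Rightarrow> real) set" where
  "line_norms = {\<lambda>x. norm (x 0)}"

lemma cring_scalars: "cring (scalars :: 'k::real_normed_field ring)"
proof (rule cringI)
  show "abelian_group (scalars :: 'k ring)"
  proof (rule abelian_groupI)
    fix x :: 'k
    show "\<exists>y\<in>carrier scalars. y \<oplus>\<^bsub>scalars\<^esub> x = \<zero>\<^bsub>scalars\<^esub>"
      by (intro bexI[of _ "- x"]) (auto simp: scalars_def)
  qed (auto simp: scalars_def algebra_simps)
  show "comm_monoid (scalars :: 'k ring)"
    by (rule comm_monoidI) (auto simp: scalars_def)
qed (auto simp: scalars_def algebra_simps)

lemma module_line: "module scalars (line :: ('k::real_normed_field, nat \<Rightarrow> 'k) module)"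
proof (rule moduleI)
  show "cring (scalars :: 'k ring)" by (rule cring_scalars)
  show "abelian_group (line :: ('k, nat \<Rightarrow> 'k) module)"
  proof (rule abelian_groupI)
    fix x :: "nat \<Rightarrow> 'k" assume "x \<in> carrier line"
    then show "\<exists>y\<in>carrier line. y \<oplus>\<^bsub>line\<^esub> x = \<zero>\<^bsub>line\<^esub>"
      by (intro bexI[of _ "\<lambda>i. - x i"]) (auto simp: line_def)
  qed (auto simp: line_def algebra_simps)
qed (auto simp: line_def scalars_def algebra_simps)

lemma locally_convex_line: "locally_convex_space line line_norms"
  unfolding locally_convex_space_def seminorm_on_def line_norms_def
  using module_line by (auto simp: line_def norm_mult norm_triangle_ineq)

lemma minus_line:
  assumes "x \<in> carrier line" "y \<in> carrier line"
  shows "(x \<ominus>\<^bsub>line\<^esub> y) = (\<lambda>i. x i - y i)"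
proof -
  interpret L: abelian_group line using module_line by (rule module.axioms)
  have "\<ominus>\<^bsub>line\<^esub> y = (\<lambda>i. - y i)"
    using assms by (intro L.minus_equality) (auto simp: line_def)
  then show ?thesis by (simp add: a_minus_def line_def)
qed

lemma moderate_line_iff:
  "u \<in> moderate_nets line line_norms \<longleftrightarrow>
     u \<in> nets line \<and> (\<exists>M::nat. \<forall>\<^sub>F \<epsilon> in at_right 0. norm (u \<epsilon> 0) \<le> \<epsilon> powi (- int M))"
  by (simp add: moderate_nets_def line_norms_def eventually_at_right_0_closed)

lemma colombeau_rel_line_iff:
  "(u, v) \<in> colombeau_rel line line_norms \<longleftrightarrow>
     u \<in> moderate_nets line line_norms \<and> v \<in> moderate_nets line line_norms \<and>
     (\<forall>m::nat. \<forall>\<^sub>F \<epsilon> in at_right 0. norm (u \<epsilon> 0 - v \<epsilon> 0) \<le> \<epsilon> ^ m)"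
proof (cases "u \<in> nets line \<and> v \<in> nets line")
  case True
  then have car: "u \<epsilon> \<in> carrier line" "v \<epsilon> \<in> carrier line" if "\<epsilon> \<in> {0<..<1}" for \<epsilon>
    using that by (auto simp: nets_def)
  have val: "(\<lambda>\<epsilon>\<in>{0<..<1}. u \<epsilon> \<ominus>\<^bsub>line\<^esub> v \<epsilon>) \<epsilon> = (\<lambda>i. u \<epsilon> i - v \<epsilon> i)" if "\<epsilon> \<in> {0<..<1}" for \<epsilon>
    using that car minus_line by auto
  have "(\<lambda>\<epsilon>\<in>{0<..<1}. u \<epsilon> \<ominus>\<^bsub>line\<^esub> v \<epsilon>) \<in> nets line"
    unfolding nets_def
  proof (rule restrict_PiE_iff[THEN iffD2], rule ballI)
    fix \<epsilon> :: real assume "\<epsilon> \<in> {0<..<1}"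
    from car[OF this] show "u \<epsilon> \<ominus>\<^bsub>line\<^esub> v \<epsilon> \<in> carrier line"
      by (simp add: minus_line) (auto simp: line_def)
  qed
  moreover have "(\<forall>\<^sub>F \<epsilon> in at_right 0. norm ((\<lambda>\<epsilon>\<in>{0<..<1}. u \<epsilon> \<ominus>\<^bsub>line\<^esub> v \<epsilon>) \<epsilon> 0) \<le> \<epsilon> ^ m) \<longleftrightarrow>
      (\<forall>\<^sub>F \<epsilon> in at_right 0. norm (u \<epsilon> 0 - v \<epsilon> 0) \<le> \<epsilon> ^ m)" for m
    by (rule eventually_cong[OF eventually_at_right_0_small[of 1]]) (auto simp: minus_line car)
  ultimately show ?thesis
    by (simp add: colombeau_rel_def negligible_nets_def line_norms_def eventually_at_right_0_closed)
next
  case False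
  then show ?thesis by (auto simp: colombeau_rel_def moderate_nets_def)
qed

lemma colombeau_rel_line_refl:
  "u \<in> moderate_nets line line_norms \<Longrightarrow> (u, u) \<in> colombeau_rel line line_norms"
  using eventually_at_right_0_small[of 1]
  by (auto simp: colombeau_rel_line_iff elim!: eventually_mono)

lemma class_in_internal_line_iff:
  assumes "u \<in> moderate_nets line line_norms"
  shows "colombeau_rel line line_norms `` {u} \<in> internal_set_of line line_norms C \<longleftrightarrow>
    (\<exists>v. (u, v) \<in> colombeau_rel line line_norms \<and> (\<forall>\<^sub>F \<epsilon> in at_right 0. v \<epsilon> \<in> C \<epsilon>))"
  using assms
  by (auto simp: internal_set_of_def colombeau_space_def eventually_at_right_0_open intro: quotientI)

section \<open>Two internal sets whose intersection is external\<close>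

definition integer_points :: "real \<Rightarrow> (nat \<Rightarrow> 'k::real_normed_field) set" where
  "integer_points \<epsilon> = {\<lambda>_. of_nat n | n. n \<ge> 1}"

definition shifted_points :: "real \<Rightarrow> (nat \<Rightarrow> 'k::real_normed_field) set" where
  "shifted_points \<epsilon> = {\<lambda>_. of_real (real n + \<epsilon> ^ n) | n. n \<ge> 1}"

lemma diverging_in_Int:
  fixes n :: "real \<Rightarrow> nat"
  assumes lim: "filterlim n at_top (at_right 0)" and bound: "\<forall>\<epsilon>>0. real (n \<epsilon>) \<le> 1 / \<epsilon>"
  defines "u \<equiv> (\<lambda>\<epsilon>\<in>{0<..<1}. (\<lambda>_. of_nat (n \<epsilon>) :: 'k::real_normed_field))"
  shows "u \<in> moderate_nets line line_norms"
    and "colombeau_rel line line_norms `` {u} \<in>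
           internal_set_of line line_norms integer_points \<inter> internal_set_of line line_norms shifted_points"
proof -
  define v where "v = (\<lambda>\<epsilon>\<in>{0<..<1}. (\<lambda>_::nat. of_real (real (n \<epsilon>) + \<epsilon> ^ n \<epsilon>) :: 'k))"
  have large: "\<forall>\<^sub>F \<epsilon> in at_right 0. K \<le> n \<epsilon>" for K
    using lim by (simp add: filterlim_at_top)
  have unit: "\<forall>\<^sub>F \<epsilon> in at_right (0::real). 0 < \<epsilon> \<and> \<epsilon> < 1"
    by (rule eventually_at_right_0_small) simp
  have "\<forall>\<^sub>F \<epsilon> in at_right 0. norm (u \<epsilon> 0) \<le> \<epsilon> powi (- int 1)"
    using unit
  proof eventually_elim
    case (elim \<epsilon>)
    then show ?case using bound
      by (simp add: u_def power_int_minus inverse_eq_divide)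
  qed
  moreover have "u \<in> nets line" by (auto simp: u_def nets_def line_def)
  ultimately show u: "u \<in> moderate_nets line line_norms"
    unfolding moderate_line_iff by blast
  have "\<forall>\<^sub>F \<epsilon> in at_right 0. norm (v \<epsilon> 0) \<le> \<epsilon> powi (- int 2)"
    using eventually_at_right_0_small[of "1/2"]
  proof (rule eventually_mono)
    fix \<epsilon> :: real assume \<epsilon>: "0 < \<epsilon> \<and> \<epsilon> < 1/2"
    have "norm (v \<epsilon> 0) = real (n \<epsilon>) + \<epsilon> ^ n \<epsilon>" using \<epsilon> by (simp add: v_def del: of_real_add)
    also have "\<dots> \<le> 1 / \<epsilon> + 1" using \<epsilon> bound by (intro add_mono power_le_one) auto
    also have "\<dots> \<le> 2 * (1 / \<epsilon>)" using \<epsilon> by (simp add: field_simps)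
    also have "\<dots> \<le> (1 / \<epsilon>) * (1 / \<epsilon>)" using \<epsilon> by (intro mult_right_mono) (auto simp: field_simps)
    also have "\<dots> = \<epsilon> powi (- int 2)" by (simp add: power_int_minus field_simps power2_eq_square)
    finally show "norm (v \<epsilon> 0) \<le> \<epsilon> powi (- int 2)" .
  qed simp
  moreover have "v \<in> nets line" by (auto simp: v_def nets_def line_def)
  ultimately have v: "v \<in> moderate_nets line line_norms"
    unfolding moderate_line_iff by blast
  have "\<forall>\<^sub>F \<epsilon> in at_right 0. norm (u \<epsilon> 0 - v \<epsilon> 0) \<le> \<epsilon> ^ m" for m
    using unit large[of m]
  proof eventually_elim
    case (elim \<epsilon>)
    then have "norm (u \<epsilon> 0 - v \<epsilon> 0) = \<epsilon> ^ n \<epsilon>"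
      by (simp add: u_def v_def norm_power)
    also have "\<dots> \<le> \<epsilon> ^ m" using elim by (intro power_decreasing) auto
    finally show ?case .
  qed
  then have uv: "(u, v) \<in> colombeau_rel line line_norms"
    using u v by (simp add: colombeau_rel_line_iff)
  have "\<forall>\<^sub>F \<epsilon> in at_right 0. u \<epsilon> \<in> integer_points \<epsilon>"
    using unit large[of 1] by eventually_elim (auto simp: u_def integer_points_def)
  moreover have "\<forall>\<^sub>F \<epsilon> in at_right 0. v \<epsilon> \<in> shifted_points \<epsilon>"
    using unit large[of 1] by eventually_elim (auto simp: v_def shifted_points_def)
  ultimately show "colombeau_rel line line_norms `` {u} \<in>
      internal_set_of line line_norms integer_points \<inter> internal_set_of line line_norms shifted_points"
    using class_in_internal_line_iff[OF u] colombeau_rel_line_refl[OF u] uv by blast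
qed

text \<open>
  If an integer \<open>n\<close> and a point \<open>k + \<epsilon>\<^sup>k\<close> with \<open>k \<ge> 1\<close> are both close to a point of norm at most
  \<open>K\<close>, then \<open>n = k \<le> K + 1\<close>, so that their distance \<open>\<epsilon>\<^sup>k\<close> is at least \<open>\<epsilon>\<close> to the power \<open>K + 1\<close>,
  which is not negligible.
\<close>

lemma bounded_notin_Int:
  fixes w :: "real \<Rightarrow> nat \<Rightarrow> 'k::real_normed_field"
  assumes w: "w \<in> moderate_nets line line_norms"
    and K: "\<forall>\<^sub>F \<epsilon> in at_right 0. norm (w \<epsilon> 0) \<le> real K"
  shows "colombeau_rel line line_norms `` {w} \<notin>
           internal_set_of line line_norms integer_points \<inter> internal_set_of line line_norms shifted_points"
proof
  assume "colombeau_rel line line_norms `` {w} \<in>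
    internal_set_of line line_norms integer_points \<inter> internal_set_of line line_norms shifted_points"
  then obtain a b where a: "(w, a) \<in> colombeau_rel line line_norms" "\<forall>\<^sub>F \<epsilon> in at_right 0. a \<epsilon> \<in> integer_points \<epsilon>"
    and b: "(w, b) \<in> colombeau_rel line line_norms" "\<forall>\<^sub>F \<epsilon> in at_right 0. b \<epsilon> \<in> shifted_points \<epsilon>"
    unfolding Int_iff class_in_internal_line_iff[OF w] by blast
  have "\<forall>\<^sub>F \<epsilon> in at_right 0. norm (w \<epsilon> 0 - a \<epsilon> 0) \<le> \<epsilon> ^ (K + 2)"
    "\<forall>\<^sub>F \<epsilon> in at_right 0. norm (w \<epsilon> 0 - b \<epsilon> 0) \<le> \<epsilon> ^ (K + 2)"
    using a(1) b(1) by (simp_all only: colombeau_rel_line_iff)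
  moreover have "\<forall>\<^sub>F \<epsilon> in at_right (0::real). 0 < \<epsilon> \<and> \<epsilon> < 1/4"
    by (rule eventually_at_right_0_small) simp
  ultimately have "\<forall>\<^sub>F \<epsilon> in at_right (0::real). False"
    using a(2) b(2) K
  proof eventually_elim
    case (elim \<epsilon>)
    obtain n where n: "n \<ge> 1" "a \<epsilon> = (\<lambda>_. of_nat n)" using elim by (auto simp: integer_points_def)
    obtain k where k: "k \<ge> 1" "b \<epsilon> = (\<lambda>_. of_real (real k + \<epsilon> ^ k))" using elim by (auto simp: shifted_points_def)
    have "\<epsilon> ^ (K + 2) \<le> \<epsilon> ^ 1" "\<epsilon> ^ k \<le> \<epsilon> ^ 1" using elim k by (intro power_decreasing; simp)+
    then have small: "\<epsilon> ^ (K + 2) < 1/4" "\<epsilon> ^ k < 1/4" using elim unfolding power_one_right by linarith+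
    have "norm (of_real (real n - (real k + \<epsilon> ^ k)) :: 'k) = norm (a \<epsilon> 0 - b \<epsilon> 0)"
      using n k by simp
    also have "\<dots> \<le> norm (w \<epsilon> 0 - a \<epsilon> 0) + norm (w \<epsilon> 0 - b \<epsilon> 0)"
      by (metis norm_minus_commute norm_triangle_sub dist_norm dist_triangle3)
    also have "\<dots> \<le> 2 * \<epsilon> ^ (K + 2)" using elim by simp
    finally have ab: "\<bar>real n - (real k + \<epsilon> ^ k)\<bar> \<le> 2 * \<epsilon> ^ (K + 2)"
      unfolding norm_of_real .
    have "0 < \<epsilon> ^ k" using elim by simp
    then have "\<bar>real n - real k\<bar> < 1" using ab small by linarith
    then have nk: "n = k" by linarith
    have "real n = norm (a \<epsilon> 0)" using n by simp
    also have "\<dots> \<le> norm (w \<epsilon> 0) + norm (w \<epsilon> 0 - a \<epsilon> 0)"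
      by (metis norm_minus_commute norm_triangle_sub)
    also have "\<dots> < real K + 1" using elim small by linarith
    finally have "k \<le> K + 1" using nk by linarith
    then have "\<epsilon> ^ (K + 1) \<le> \<epsilon> ^ k" using elim by (intro power_decreasing) auto
    also have "\<dots> \<le> 2 * \<epsilon> ^ (K + 2)" using ab nk by simp
    also have "\<dots> = \<epsilon> ^ (K + 1) * (2 * \<epsilon>)" by simp
    finally have "\<epsilon> ^ (K + 1) * 1 \<le> \<epsilon> ^ (K + 1) * (2 * \<epsilon>)" by simp
    then have "1 \<le> 2 * \<epsilon>" using elim by (subst (asm) mult_le_cancel_left_pos) auto
    then show False using elim by simp
  qed
  then show False by simp
qed

lemma internal_set_of_line:
  assumes "\<And>\<epsilon>. C \<epsilon> \<subseteq> carrier line"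
  shows "internal_set_of line line_norms C \<subseteq> colombeau_space line line_norms"
    and "internal line line_norms (internal_set_of line line_norms C)"
proof -
  show "internal_set_of line line_norms C \<subseteq> colombeau_space line line_norms"
    by (auto simp: internal_set_of_def)
  show "internal line line_norms (internal_set_of line line_norms C)"
    unfolding internal_def by (intro exI[of _ C] conjI ballI assms refl)
qed

lemma not_internal_Int:
  "\<not> internal line (line_norms :: ((nat \<Rightarrow> 'k::real_normed_field) \<Rightarrow> real) set)
     (internal_set_of line line_norms integer_points \<inter> internal_set_of line line_norms shifted_points)" (is "\<not> internal _ _ ?S")
proof
  assume "internal line (line_norms :: ((nat \<Rightarrow> 'k) \<Rightarrow> real) set) ?S"
  then obtain C :: "real \<Rightarrow> (nat \<Rightarrow> 'k) set" where
    C: "\<forall>\<epsilon>\<in>{0<..<1}. C \<epsilon> \<subseteq> carrier line" and S: "?S = internal_set_of line line_norms C"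
    unfolding internal_def by (elim exE conjE)
  define R where "R k \<epsilon> \<longleftrightarrow> (\<exists>x\<in>C \<epsilon>. norm (x 0 - of_nat k) \<le> 1)" for k \<epsilon>
  have "\<exists>k. \<forall>\<^sub>F \<epsilon> in at_right 0. R k \<epsilon>"
  proof (rule diagonal_underspill)
    fix n :: "real \<Rightarrow> nat"
    assume n: "filterlim n at_top (at_right 0)" "\<forall>\<epsilon>>0. real (n \<epsilon>) \<le> 1 / \<epsilon>"
    let ?u = "\<lambda>\<epsilon>\<in>{0<..<1}. (\<lambda>_::nat. of_nat (n \<epsilon>) :: 'k)"
    have u: "?u \<in> moderate_nets line line_norms"
      by (rule diverging_in_Int(1)[OF n])
    have "colombeau_rel line line_norms `` {?u} \<in> ?S"
      by (rule diverging_in_Int(2)[OF n])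
    then have "colombeau_rel line line_norms `` {?u} \<in> internal_set_of line line_norms C"
      unfolding S .
    then obtain v where v: "(?u, v) \<in> colombeau_rel line line_norms" "\<forall>\<^sub>F \<epsilon> in at_right 0. v \<epsilon> \<in> C \<epsilon>"
      unfolding class_in_internal_line_iff[OF u] by blast
    have "\<forall>\<^sub>F \<epsilon> in at_right 0. norm (?u \<epsilon> 0 - v \<epsilon> 0) \<le> \<epsilon> ^ 0"
      using v(1) unfolding colombeau_rel_line_iff by blast
    then show "\<forall>\<^sub>F \<epsilon> in at_right 0. R (n \<epsilon>) \<epsilon>"
      using v(2) eventually_at_right_0_small[of 1, OF zero_less_one]
    proof eventually_elim
      case (elim \<epsilon>)
      then show ?case
        by (auto simp: R_def norm_minus_commute intro!: bexI[of _ "v \<epsilon>"])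
    qed
  qed
  then obtain k where k: "\<forall>\<^sub>F \<epsilon> in at_right 0. R k \<epsilon>" ..
  define w where "w = (\<lambda>\<epsilon>\<in>{0<..<1}. if R k \<epsilon> then SOME x. x \<in> C \<epsilon> \<and> norm (x 0 - of_nat k) \<le> 1
                                   else (\<lambda>_. 0))"
  have wR: "w \<epsilon> \<in> C \<epsilon> \<and> norm (w \<epsilon> 0 - of_nat k) \<le> 1" if "\<epsilon> \<in> {0<..<1}" "R k \<epsilon>" for \<epsilon>
  proof -
    have "\<exists>x. x \<in> C \<epsilon> \<and> norm (x 0 - of_nat k) \<le> 1" using that by (auto simp: R_def)
    from someI_ex[OF this] show ?thesis using that by (simp add: w_def)
  qed
  have "w \<epsilon> \<in> carrier line" if "\<epsilon> \<in> {0<..<1}" for \<epsilon>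
  proof (cases "R k \<epsilon>")
    case True
    then show ?thesis using wR[OF that] bspec[OF C that] by blast
  next
    case False
    then show ?thesis using that by (auto simp: w_def line_def)
  qed
  then have nets: "w \<in> nets line" by (auto simp: nets_def w_def PiE_def extensional_def)
  have near: "\<forall>\<^sub>F \<epsilon> in at_right 0. w \<epsilon> \<in> C \<epsilon> \<and> norm (w \<epsilon> 0 - of_nat k) \<le> 1"
    using k eventually_at_right_0_small[of 1, OF zero_less_one]
    by eventually_elim (simp add: wR)
  have bounded: "\<forall>\<^sub>F \<epsilon> in at_right 0. norm (w \<epsilon> 0) \<le> real (k + 1)"
    using near
  proof eventually_elim
    case (elim \<epsilon>)
    then show ?case using norm_triangle_sub[of "w \<epsilon> 0" "of_nat k"] by simp
  qed
  have "\<forall>\<^sub>F \<epsilon> in at_right (0::real). 0 < \<epsilon> \<and> \<epsilon> < 1 / real (k + 1)"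
    by (rule eventually_at_right_0_small) simp
  with bounded have "\<forall>\<^sub>F \<epsilon> in at_right 0. norm (w \<epsilon> 0) \<le> \<epsilon> powi (- int 1)"
  proof eventually_elim
    case (elim \<epsilon>)
    have "real (k + 1) \<le> 1 / \<epsilon>" using elim by (simp add: field_simps)
    then show ?case using elim by (simp add: power_int_minus inverse_eq_divide)
  qed
  then have w: "w \<in> moderate_nets line line_norms"
    using nets unfolding moderate_line_iff by blast
  have "colombeau_rel line line_norms `` {w} \<in> internal_set_of line line_norms C"
    unfolding class_in_internal_line_iff[OF w]
    using near colombeau_rel_line_refl[OF w] by (auto elim: eventually_mono)
  then show False
    using bounded_notin_Int[OF w bounded] unfolding S by blast
qed

theorem mainTheorem12:
  "\<exists>(E :: ('k::real_normed_field, nat \<Rightarrow> 'k) module) (P :: ((nat \<Rightarrow> 'k) \<Rightarrow> real) set).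
     locally_convex_space E P \<and>
     (\<exists>A B. A \<subseteq> colombeau_space E P \<and> B \<subseteq> colombeau_space E P \<and>
        internal E P A \<and> internal E P B \<and> \<not> internal E P (A \<inter> B))"
proof -
  let ?A = "internal_set_of line line_norms integer_points :: (real \<Rightarrow> nat \<Rightarrow> 'k) set set"
  let ?B = "internal_set_of line line_norms shifted_points :: (real \<Rightarrow> nat \<Rightarrow> 'k) set set"
  have "integer_points \<epsilon> \<subseteq> carrier (line :: ('k, nat \<Rightarrow> 'k) module)"
    "shifted_points \<epsilon> \<subseteq> carrier (line :: ('k, nat \<Rightarrow> 'k) module)" for \<epsilon>
    by (auto simp: integer_points_def shifted_points_def line_def)
  note AB = this[THEN internal_set_of_line(1)] this[THEN internal_set_of_line(2)]
  have "?A \<subseteq> colombeau_space line line_norms \<and> ?B \<subseteq> colombeau_space line line_norms \<and>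
      internal line line_norms ?A \<and> internal line line_norms ?B \<and>
      \<not> internal line line_norms (?A \<inter> ?B)"
    by (intro conjI AB not_internal_Int)
  then have "\<exists>A B. A \<subseteq> colombeau_space line line_norms \<and> B \<subseteq> colombeau_space line line_norms \<and>
      internal line line_norms A \<and> internal line line_norms B \<and>
      \<not> internal (line :: ('k, nat \<Rightarrow> 'k) module) line_norms (A \<inter> B)"
    by (intro exI)
  then show ?thesis
    using locally_convex_line by (intro exI[of _ line] exI[of _ line_norms] conjI)
qed

end
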